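(* Let $\mathcal{P}$ be a two-dimensional pattern with weights. If $\mathrm{Poly}_{\mathcal{P}}(x,y)$ has a non-trivial strongly linear divisor, then $\mathcal{P}$ is not abelian rigid; that is, there exists a two-dimensional word $\mathbf{w}$ over a finite alphabet which is not fully periodic and satisfies $a_{\mathbf{w}}(\mathcal{P})=1$.
   Context: A figure with weights in $\mathbb{Z}^2$ is a finite set $\{(u,g_u): u\in F, g_u\in\mathbb{Z}\}$ with $F\subset\mathbb{Z}^2$ finite; a pattern with weights is the set of all integer translates (points shifted, weights kept) of a fixed figure with weights. The canonical figure $F_{\mathcal{P}}$ is the member of $\mathcal{P}$ whose points have nonnegative coordinates, with some point having first coordinate $0$ and some point having second coordinate $0$; $\mathrm{Poly}_{\mathcal{P}}(x,y)=\sum_{((t_1,t_2),g_t)\in F_{\mathcal{P}}} g_t x^{t_1}y^{t_2}$. For $v=(v_1,v_2)\in\mathbb{Z}^2$ and a natural number $n$, $l(v,n)=\sum_{i=0}^n x^{iv_1}y^{iv_2}$ is strongly linear; it is non-trivial if $v\ne0$ and $n\ge1$; divisibility is in the Laurent polynomial ring $\mathbb{Z}[x^{\pm1},y^{\pm1}]$. For a word $\mathbf{w}:\mathbb{Z}^2\to A=\{a_1,\dots,a_k\}$ and $F^w=\{(u_1,g_1),\dots,(u_l,g_l)\}$, the linear combination of $\mathbf{w}$ over $F^w$ is the formal expression $\sum_i g_i\mathbf{w}(u_i)\in\mathbb{Z}[a_1,\dots,a_k]$; $a_{\mathbf{w}}(\mathcal{P})$ is the number of distinct such combinations over $F^w\in\mathcal{P}$.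 A word is fully periodic if it has two linearly independent period vectors $p$ ($\mathbf{w}(x+p)=\mathbf{w}(x)$ for all $x$). $\mathcal{P}$ is abelian rigid if $a_{\mathbf{w}}(\mathcal{P})=1$ holds only for fully periodic words $\mathbf{w}$. *)

theory Defs
  imports Main "HOL-Library.Product_Plus" "HOL-Library.Poly_Mapping"
begin

type_synonym point = "int \<times> int"

(* A weighted figure is the graph of an integer-valued function on a finite set of points;
   zero weights are allowed and the empty figure is not excluded. *)
type_synonym figure = "(point \<times> int) set"

definition weighted_figure :: "figure \<Rightarrow> bool" where
  "weighted_figure F \<longleftrightarrow> finite F \<and> single_valued F"

definition translate :: "point \<Rightarrow> figure \<Rightarrow> figure" where
  "translate t F = (\<lambda>(u, g). (u + t, g)) ` F"

definition weighted_pattern :: "figure set \<Rightarrow> bool" where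
  "weighted_pattern P \<longleftrightarrow> (\<exists>F. weighted_figure F \<and> P = range (\<lambda>t. translate t F))"

(* The guard F \<noteq> {} only concerns the pattern {{}}, whose canonical figure is thereby {}
   and whose polynomial is 0. *)
definition is_canonical :: "figure \<Rightarrow> bool" where
  "is_canonical F \<longleftrightarrow>
     (\<forall>(u, g)\<in>F. 0 \<le> fst u \<and> 0 \<le> snd u) \<and>
     (F \<noteq> {} \<longrightarrow> (\<exists>(u, g)\<in>F. fst u = 0) \<and> (\<exists>(u, g)\<in>F. snd u = 0))"

definition canonical_figure :: "figure set \<Rightarrow> figure" where
  "canonical_figure P = (THE F. F \<in> P \<and> is_canonical F)"

lemma canonical_figure_ex1:
  assumes "weighted_pattern P"
  shows "\<exists>!F. F \<in> P \<and> is_canonical F"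
proof -
  from assms obtain F0 where F0: "finite F0" and P: "P = range (\<lambda>t. translate t F0)"
    by (auto simp: weighted_pattern_def weighted_figure_def)
  show ?thesis
  proof (cases "F0 = {}")
    case True
    then have "P = {{}}" by (auto simp: P translate_def)
    then show ?thesis by (auto simp: is_canonical_def)
  next
    case False
    let ?X = "(\<lambda>z. fst (fst z)) ` F0" and ?Y = "(\<lambda>z. snd (fst z)) ` F0"
    let ?t = "(- Min ?X, - Min ?Y)"
    have fin: "finite ?X" "finite ?Y" "?X \<noteq> {}" "?Y \<noteq> {}"
      using F0 False by auto
    have can: "is_canonical (translate t F0) \<longleftrightarrow> t = ?t" for t
    proof
      assume c: "is_canonical (translate t F0)"
      have ne: "translate t F0 \<noteq> {}" using False by (auto simp: translate_def)
      have "Min ?X = - fst t"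
      proof (rule Min_eqI)
        show "finite ?X" by fact
        show "\<And>y. y \<in> ?X \<Longrightarrow> - fst t \<le> y"
          using c by (fastforce simp: is_canonical_def translate_def)
        from c ne obtain z where "z \<in> F0" "fst (fst z) + fst t = 0"
          by (auto simp: is_canonical_def translate_def)
        then show "- fst t \<in> ?X"
          by (metis add.commute image_eqI minus_unique)
      qed
      moreover have "Min ?Y = - snd t"
      proof (rule Min_eqI)
        show "finite ?Y" by fact
        show "\<And>y. y \<in> ?Y \<Longrightarrow> - snd t \<le> y"
          using c by (fastforce simp: is_canonical_def translate_def)
        from c ne obtain z where "z \<in> F0" "snd (fst z) + snd t = 0"
          by (auto simp: is_canonical_def translate_def)
        then show "- snd t \<in> ?Y"
          by (metis add.commute image_eqI minus_unique)
      qed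
      ultimately show "t = ?t" by (simp add: prod_eq_iff)
    next
      assume t: "t = ?t"
      obtain z1 where z1: "z1 \<in> F0" "fst (fst z1) = Min ?X"
        using Min_in[OF fin(1,3)] by auto
      obtain z2 where z2: "z2 \<in> F0" "snd (fst z2) = Min ?Y"
        using Min_in[OF fin(2,4)] by auto
      have "\<forall>z\<in>F0. Min ?X \<le> fst (fst z) \<and> Min ?Y \<le> snd (fst z)"
        using fin by (auto intro: Min_le)
      then show "is_canonical (translate t F0)"
        using z1 z2 unfolding is_canonical_def translate_def t
        by (auto simp: case_prod_beta intro: bexI[of _ z1] bexI[of _ z2])
    qed
    show ?thesis
      unfolding P using can by (intro ex1I[of _ "translate ?t F0"]) auto
  qed
qed

(* The Laurent polynomial ring over the integers in x, y is the group ring of the exponent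
   group: multiplication of poly_mapping is convolution, and negative exponents are allowed. *)
type_synonym laurent2 = "(int \<times> int) \<Rightarrow>\<^sub>0 int"

definition Poly_pattern :: "figure set \<Rightarrow> laurent2" where
  "Poly_pattern P = (\<Sum>(t, g)\<in>canonical_figure P. Poly_Mapping.single t g)"

definition strongly_linear :: "point \<Rightarrow> nat \<Rightarrow> laurent2" where
  "strongly_linear v n =
     (\<Sum>i = 0..n. Poly_Mapping.single (int i * fst v, int i * snd v) 1)"

definition has_nontrivial_strongly_linear_divisor :: "laurent2 \<Rightarrow> bool" where
  "has_nontrivial_strongly_linear_divisor p \<longleftrightarrow>
     (\<exists>v n. v \<noteq> 0 \<and> 1 \<le> n \<and> strongly_linear v n dvd p)"

type_synonym 'a word2 = "point \<Rightarrow> 'a"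

(* Polynomials with integer coefficients whose indeterminates are the letters:
   the keys 'a => nat of finite support are the monomials. *)
type_synonym 'a letter_poly = "('a \<Rightarrow>\<^sub>0 nat) \<Rightarrow>\<^sub>0 int"

definition letter_var :: "'a \<Rightarrow> 'a letter_poly" where
  "letter_var a = Poly_Mapping.single (Poly_Mapping.single a 1) 1"

definition lin_comb :: "'a word2 \<Rightarrow> figure \<Rightarrow> 'a letter_poly" where
  "lin_comb w F = (\<Sum>(u, g)\<in>F. of_int g * letter_var (w u))"

(* For a word over a finite alphabet the set counted here is finite. *)
definition abelian_complexity :: "'a word2 \<Rightarrow> figure set \<Rightarrow> nat" where
  "abelian_complexity w P = card (lin_comb w ` P)"

definition is_period :: "'a word2 \<Rightarrow> point \<Rightarrow> bool" where
  "is_period w p \<longleftrightarrow> (\<forall>x. w (x + p) = w x)"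

(* For integer vectors, independence over the integers and over the reals coincide. *)
definition linearly_independent2 :: "point \<Rightarrow> point \<Rightarrow> bool" where
  "linearly_independent2 p q \<longleftrightarrow>
     (\<forall>a b :: int. a * fst p + b * fst q = 0 \<and> a * snd p + b * snd q = 0 \<longrightarrow> a = 0 \<and> b = 0)"

definition fully_periodic :: "'a word2 \<Rightarrow> bool" where
  "fully_periodic w \<longleftrightarrow> (\<exists>p q. is_period w p \<and> is_period w q \<and> linearly_independent2 p q)"

(* Letters are natural numbers: up to renaming of letters this covers all finite alphabets,
   and all notions involved are invariant under renaming. *)
definition abelian_rigid :: "figure set \<Rightarrow> bool" where
  "abelian_rigid P \<longleftrightarrow>
     (\<forall>(A :: nat set) w. finite A \<and> range w \<subseteq> A \<and> abelian_complexity w P = 1 \<longrightarrow> fully_periodic w)"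

end

theory Submission
  imports Defs
begin

text \<open>
  Write \<open>N = n + 1\<close>. Colour the plane with the \<open>N\<close> residues modulo \<open>N\<close> so that a step by \<open>v\<close>
  increases the colour by one; then every segment \<open>x, x + v, \<dots>, x + n v\<close> carries each colour
  exactly once. The linear combination over a translate of \<open>F\<close> is the value at \<open>Poly\<^sub>P\<close> of an
  additive map, so a factor \<open>l(v,n)\<close> of \<open>Poly\<^sub>P\<close> makes it independent of the translation. The colours
  on distinct lines parallel to \<open>v\<close> can be shifted independently; shifting only the line through the
  origin destroys every period that is not parallel to \<open>v\<close>.
\<close>

text \<open>Polynomials are treated as elements of free abelian groups, where
  \<open>frag_extend\<close> is the additive map fixed by its values on monomials.\<close>

lemma of_int_mult_eq_frag_cmul:
  "of_int g * p = frag_cmul g (p :: ('a::monoid_add) \<Rightarrow>\<^sub>0 int)"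
  by (induction g rule: int_induct[of _ 0])
    (simp_all add: distrib_right left_diff_distrib frag_cmul_distrib frag_cmul_diff_distrib)

lemma frag_extend_single: "frag_extend f (Poly_Mapping.single u g) = frag_cmul g (f u)"
  by (simp add: frag_extend_def)

lemma lin_comb_translate:
  assumes "finite F"
  shows "lin_comb w (translate t F) =
    frag_extend (\<lambda>u. letter_var (w (u + t))) (\<Sum>(u, g)\<in>F. Poly_Mapping.single u g)"
proof -
  have inj: "inj_on (\<lambda>(u, g). (u + t, g)) F"
    by (auto simp: inj_on_def)
  show ?thesis
    unfolding lin_comb_def translate_def
    by (subst sum.reindex[OF inj], subst frag_extend_sum[OF assms], rule sum.cong)
      (auto simp: of_int_mult_eq_frag_cmul frag_extend_single)
qed

text \<open>By additivity in \<open>q\<close>, it suffices to take a monomial at \<open>s\<close>: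
  its product with \<open>strongly_linear v n\<close> is a segment starting at \<open>s\<close>. The
  gain is that \<open>f\<close> no longer occurs on the right.\<close>

lemma frag_extend_strongly_linear_mult:
  assumes "\<And>s. (\<Sum>i=0..n. f (s + (int i * fst v, int i * snd v))) = C"
  shows "frag_extend f (strongly_linear v n * q) = frag_extend (\<lambda>_. C) q"
proof -
  have "Poly_Mapping.keys q \<subseteq> UNIV" by simp
  then show ?thesis
  proof (induction q rule: frag_induction)
    case (one s)
    show ?case
      using assms[of s]
      by (simp add: strongly_linear_def sum_distrib_right mult_single frag_extend_sum o_def
          add.commute)
  qed (simp_all add: right_diff_distrib frag_extend_diff)
qed

lemma translate_translate: "translate s (translate t F) = translate (t + s) F"
  by (force simp: translate_def image_image case_prod_beta add.assoc)

lemma weighted_pattern_canonical_figure: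
  assumes "weighted_pattern P"
  shows "finite (canonical_figure P)" "P = range (\<lambda>t. translate t (canonical_figure P))"
proof -
  from assms obtain F where F: "finite F" and P: "P = range (\<lambda>t. translate t F)"
    by (auto simp: weighted_pattern_def weighted_figure_def)
  have "canonical_figure P \<in> P"
    using theI'[OF canonical_figure_ex1[OF assms]] by (simp add: canonical_figure_def)
  then obtain s where s: "canonical_figure P = translate s F"
    unfolding P by blast
  show "finite (canonical_figure P)"
    unfolding s using F by (simp add: translate_def)
  \<comment> \<open>Shifting the parameter by \<open>s\<close> permutes the translations, so both
    figures generate the same pattern.\<close>
  have "surj (\<lambda>t. s + t)"
    by (rule surjI[of _ "\<lambda>t. t - s"]) simp
  then have "(\<lambda>t. translate t F) ` range (\<lambda>t. s + t) = range (\<lambda>t. translate t F)"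
    by (simp only:)
  then show "P = range (\<lambda>t. translate t (canonical_figure P))"
    unfolding s translate_translate image_image by (rule trans[OF P, OF sym])
qed

lemma abelian_complexity_eq_1:
  assumes "weighted_pattern P" and "strongly_linear v n dvd Poly_pattern P"
    and seg: "\<And>s. (\<Sum>i=0..n. letter_var (w (s + (int i * fst v, int i * snd v)))) = C"
  shows "abelian_complexity w P = 1"
proof -
  obtain q where q: "Poly_pattern P = strongly_linear v n * q"
    using assms(2) by blast
  let ?F = "canonical_figure P"
  have "lin_comb w (translate t ?F) = frag_extend (\<lambda>_. C) q" for t
  proof -
    have "lin_comb w (translate t ?F) =
        frag_extend (\<lambda>u. letter_var (w (u + t))) (Poly_pattern P)"
      using weighted_pattern_canonical_figure(1)[OF assms(1)]
      by (simp add: lin_comb_translate Poly_pattern_def)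
    also have "\<dots> = frag_extend (\<lambda>_. C) q"
      unfolding q
    proof (rule frag_extend_strongly_linear_mult)
      fix s
      show "(\<Sum>i=0..n. letter_var (w (s + (int i * fst v, int i * snd v) + t))) = C"
        using seg[of "s + t"] by (simp only: add.assoc add.commute[of _ t])
    qed
    finally show ?thesis .
  qed
  then have "lin_comb w ` range (\<lambda>t. translate t ?F) = {frag_extend (\<lambda>_. C) q}"
    by (simp only: image_image image_constant_conv UNIV_not_empty if_False)
  then have "lin_comb w ` P = {frag_extend (\<lambda>_. C) q}"
    by (subst weighted_pattern_canonical_figure(2)[OF assms(1)])
  then show ?thesis
    by (simp add: abelian_complexity_def)
qed

text \<open>Any \<open>n + 1\<close> consecutive integers form a complete residue system modulo
  \<open>n + 1\<close>.\<close>

lemma sum_shifted_residues: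
  fixes a :: int
  shows "(\<Sum>i=0..n. h (nat ((a + int i) mod int (Suc n)))) = (\<Sum>j\<le>n. h j)"
proof (rule sum.reindex_bij_betw)
  let ?g = "\<lambda>i. nat ((a + int i) mod int (Suc n))"
  have inj: "inj_on ?g {0..n}"
  proof (rule inj_onI)
    fix i j assume ij: "i \<in> {0..n}" "j \<in> {0..n}" and "?g i = ?g j"
    then have "(a + int i) mod int (Suc n) = (a + int j) mod int (Suc n)"
      by (simp add: eq_nat_nat_iff)
    then have "(a + int i - a) mod int (Suc n) = (a + int j - a) mod int (Suc n)"
      by (rule mod_diff_cong) simp
    then show "i = j"
      using ij by (simp flip: of_nat_Suc)
  qed
  moreover have "?g ` {0..n} \<subseteq> {..n}"
  proof (intro image_subsetI)
    fix i
    show "?g i \<in> {..n}"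
      using pos_mod_bound[of "int (Suc n)" "a + int i"] unfolding atMost_iff by linarith
  qed
  ultimately have "?g ` {0..n} = {..n}"
    by (intro card_subset_eq) (simp_all only: card_image finite_atMost card_atLeastAtMost card_atMost diff_zero)
  with inj show "bij_betw ?g {0..n} {..n}"
    unfolding bij_betw_def by blast
qed

lemma is_period_int_multiple:
  assumes "is_period w p"
  shows "is_period w (int m * fst p, int m * snd p)"
proof (induction m)
  case 0
  then show ?case by (simp add: is_period_def flip: zero_prod_def)
next
  case (Suc m)
  have "x + (int (Suc m) * fst p, int (Suc m) * snd p)
      = x + (int m * fst p, int m * snd p) + p" for x
    by (simp add: prod_eq_iff algebra_simps)
  then show ?case
    using Suc assms unfolding is_period_def by metis
qed

text \<open>For \<open>v \<noteq> 0\<close>, the value labels the line parallel to \<open>v\<close>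
  through \<open>x\<close>.\<close>

definition cross :: "point \<Rightarrow> point \<Rightarrow> int" where
  "cross v x = fst v * snd x - snd v * fst x"

definition dot :: "point \<Rightarrow> point \<Rightarrow> int" where
  "dot v x = fst v * fst x + snd v * snd x"

text \<open>A step by \<open>v\<close> raises \<open>dot v x\<close> by \<open>dot v v\<close>,
  hence the quotient by one.\<close>

definition shifted_line_word :: "point \<Rightarrow> nat \<Rightarrow> nat word2" where
  "shifted_line_word v n x =
     nat ((dot v x div dot v v + (if cross v x = 0 then 1 else 0)) mod int (Suc n))"

lemma dot_self_pos: "v \<noteq> 0 \<Longrightarrow> dot v v > 0"
  by (auto simp: dot_def prod_eq_iff sum_squares_gt_zero_iff)

lemma not_independent_if_cross_eq_0:
  assumes "v \<noteq> 0" "cross v p = 0" "cross v q = 0"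
  shows "\<not> linearly_independent2 p q"
proof
  assume li: "linearly_independent2 p q"
  \<comment> \<open>Both vectors are parallel to \<open>v\<close>, so their components along
    \<open>v\<close> supply a vanishing combination.\<close>
  have "dot v q * fst p - dot v p * fst q = 0" "dot v q * snd p - dot v p * snd q = 0"
    using assms(2,3) unfolding cross_def dot_def by algebra+
  then have "dot v q = 0 \<and> dot v p = 0"
    using li[unfolded linearly_independent2_def, rule_format, of "dot v q" "- dot v p"] by simp
  \<comment> \<open>Now \<open>p\<close> is both parallel and orthogonal to
    \<open>v\<close>.\<close>
  then have "dot v v * fst p = 0" "dot v v * snd p = 0"
    using assms(2) unfolding cross_def dot_def by algebra+
  then have "p = 0"
    using dot_self_pos[OF assms(1)] by (simp add: prod_eq_iff)
  then show False
    using li[unfolded linearly_independent2_def, rule_format, of 1 0] by simp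
qed

lemma shifted_line_word_le: "shifted_line_word v n x \<le> n"
  using pos_mod_bound[of "int (Suc n)" "dot v x div dot v v + (if cross v x = 0 then 1 else 0)"]
  unfolding shifted_line_word_def by linarith

lemma sum_shifted_line_word:
  assumes "v \<noteq> 0"
  shows "(\<Sum>i=0..n. h (shifted_line_word v n (s + (int i * fst v, int i * snd v)))) = (\<Sum>j\<le>n. h j)"
proof -
  let ?c = "if cross v s = 0 then 1 else (0::int)"
  have "shifted_line_word v n (s + (int i * fst v, int i * snd v)) =
      nat ((dot v s div dot v v + ?c + int i) mod int (Suc n))" for i
  proof -
    have "dot v (s + (int i * fst v, int i * snd v)) = dot v s + int i * dot v v"
      "cross v (s + (int i * fst v, int i * snd v)) = cross v s"
      by (simp_all add: dot_def cross_def algebra_simps)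
    then show ?thesis
      using dot_self_pos[OF assms] by (simp add: shifted_line_word_def ac_simps)
  qed
  then show ?thesis
    using sum_shifted_residues[of h "dot v s div dot v v + ?c" n] by simp
qed

lemma shifted_line_word_period:
  assumes "v \<noteq> 0" "n \<ge> 1" "is_period (shifted_line_word v n) p"
  shows "cross v p = 0"
proof (rule ccontr)
  assume ne: "cross v p \<noteq> 0"
  define M where "M = nat (dot v v) * Suc n"
  define r where "r = (int M * fst p, int M * snd p)"
  have pos: "dot v v > 0"
    using assms(1) by (rule dot_self_pos)
  \<comment> \<open>The multiple is chosen so that it moves the first summand of the colour by a multiple of \<open>n + 1\<close>.\<close>
  have "int M = dot v v * int (Suc n)"
    using pos by (simp add: M_def algebra_simps)
  then have dot: "dot v r = dot v v * (int (Suc n) * dot v p)"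
    and "cross v r = dot v v * int (Suc n) * cross v p"
    by (simp_all add: r_def dot_def cross_def algebra_simps)
  then have "cross v r \<noteq> 0"
    using ne pos by simp
  \<comment> \<open>Off the line through the origin there is no shift, and the quotient is a
    multiple of \<open>n + 1\<close>.\<close>
  then have "shifted_line_word v n r = 0"
    using dot pos by (simp add: shifted_line_word_def del: of_nat_Suc)
  \<comment> \<open>The origin keeps its shift; \<open>n \<ge> 1\<close> prevents 1 from reducing to
    0.\<close>
  moreover have "shifted_line_word v n 0 = 1"
    using assms(2) by (simp add: shifted_line_word_def dot_def cross_def)
  moreover have "shifted_line_word v n (0 + r) = shifted_line_word v n 0"
    using is_period_int_multiple[OF assms(3), of M] unfolding r_def is_period_def by blast
  ultimately show False by simp
qed

theorem theorem3:
  fixes P :: "figure set"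
  assumes "weighted_pattern P"
    and "has_nontrivial_strongly_linear_divisor (Poly_pattern P)"
  shows "\<not> abelian_rigid P \<and>
    (\<exists>(A :: nat set) (w :: nat word2).
       finite A \<and> range w \<subseteq> A \<and> \<not> fully_periodic w \<and> abelian_complexity w P = 1)"
proof -
  obtain v n where v: "v \<noteq> 0" and n: "1 \<le> n" and dvd: "strongly_linear v n dvd Poly_pattern P"
    using assms(2) unfolding has_nontrivial_strongly_linear_divisor_def by blast
  let ?w = "shifted_line_word v n"
  \<comment> \<open>The constant \<open>C\<close> is the sum of the letters
    \<open>0, ..., n\<close>, obtained with \<open>h = letter_var\<close>.\<close>
  have "abelian_complexity ?w P = 1"
    using abelian_complexity_eq_1[OF assms(1) dvd] sum_shifted_line_word[OF v] by blast
  moreover have "\<not> fully_periodic ?w"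
    using shifted_line_word_period[OF v n] not_independent_if_cross_eq_0[OF v]
    unfolding fully_periodic_def by blast
  moreover have "range ?w \<subseteq> {..n}"
    using shifted_line_word_le by blast
  ultimately show ?thesis
    unfolding abelian_rigid_def by (meson finite_atMost)
qed

end
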